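(* Let $X\ge 0$ be a random variable with distribution $F$ and characteristic function $\phi$. Write $m_s={\bf E}[X^s]$. (a) If $s\in(2n-1,2n+1)$ for some integer $n\ge 1$, then $$m_{s}=\frac{2}{\pi}\,\Gamma(s+1)\,\cos\!\left(\frac{(s-2n)\pi}{2}\right)\int_0^{\infty}\frac{{\bf E}[h_n(tX)]}{t^{s+1}}\,dt,$$ as an equality in $[0,\infty]$ (both sides finite and equal, or both infinite). (b) If, in addition, $m_s<\infty$ for some $s\in(2n-1,2n+1)$ with integer $n\ge 1$, then $$m_{s}=\frac{2}{\pi}\,\Gamma(s+1)\,\cos\!\left(\frac{(s-2n)\pi}{2}\right)\int_0^{\infty}\frac{H_n(t)}{t^{s+1}}\,dt.$$ (c) If $m_s<\infty$ for some $s\in(0,1)$, then $$m_{s}=\frac{2}{\pi}\,\Gamma(s+1)\,\cos\!\left(\frac{s\pi}{2}\right)\int_0^{\infty}\frac{{\bf E}[\sin(tX)]}{t^{s+1}}\,dt=\frac{2}{\pi}\,\Gamma(s+1)\,\cos\!\left(\frac{s\pi}{2}\right)\int_0^{\infty}\frac{H_0(t)}{t^{s+1}}\,dt.$$ (d) If $X>0$, then the improper integral satisfies $$\int_0^{\infty}\frac{{\bf E}[\sin(tX)]}{t}\,dt=\int_0^{\infty}\frac{\mathrm{Im}(\phi(t))}{t}\,dt=\frac{\pi}{2},$$ regardless of the distribution $F$.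
   Context: The characteristic function is $\phi(t)={\bf E}[e^{itX}]$, $t\in\mathbb{R}$, and $m_k={\bf E}[X^k]$. For an integer $n\ge 1$ define $$h_n(t)=(-1)^{n}\biggl(\sin t-\sum_{k=1}^n\frac{(-1)^{k+1}}{(2k-1)!}t^{2k-1}\biggr),\quad t\in\mathbb{R};$$ it satisfies $h_n(t)\ge 0$ for $t\ge 0$, so that ${\bf E}[h_n(tX)]\in[0,\infty]$ is defined for $t\ge 0$. Provided the moments are finite, define for $n\ge 1$ $$H_n(t)=(-1)^{n}\biggl(\mathrm{Im}(\phi(t))-\sum_{k=1}^n\frac{(-1)^{k+1}}{(2k-1)!}m_{2k-1}t^{2k-1}\biggr),\quad t\in\mathbb{R},$$ and define $H_0(t)={\bf E}[\sin(tX)]$. In part (d), the improper integral $\int_0^\infty$ means the limit of $\int_\varepsilon^T$ as $\varepsilon\to 0^+$ and $T\to\infty$. *)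

theory Defs
  imports "HOL-Probability.Probability"
begin

definition h_fun :: "nat \<Rightarrow> real \<Rightarrow> real" where
  "h_fun n t = (-1) ^ n * (sin t - (\<Sum>k=1..n. (-1) ^ (k + 1) / fact (2 * k - 1) * t ^ (2 * k - 1)))"

(* For n \<ge> 1 this is meaningful only if the moments of order 2k - 1, k \<le> n, are finite:
   the Bochner integral of a non-integrable function is 0. *)
definition H_fun :: "'a measure \<Rightarrow> ('a \<Rightarrow> real) \<Rightarrow> nat \<Rightarrow> real \<Rightarrow> real" where
  "H_fun M X n t =
     (if n = 0 then (LINT \<omega>|M. sin (t * X \<omega>))
      else (-1) ^ n * (Im (char (distr M borel X) t) -
             (\<Sum>k=1..n. (-1) ^ (k + 1) / fact (2 * k - 1) *
                (LINT \<omega>|M. X \<omega> ^ (2 * k - 1)) * t ^ (2 * k - 1))))"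

(* The improper integral over (0, \<infinity>): the joint limit of the integrals over [\<epsilon>, T]
   as \<epsilon> tends to 0 from the right and T to infinity, independently of each other.
   The Lebesgue integral over (0, \<infinity>) need not exist. *)
definition has_improper_integral_0_inf :: "(real \<Rightarrow> real) \<Rightarrow> real \<Rightarrow> bool" where
  "has_improper_integral_0_inf f L \<longleftrightarrow>
     (\<forall>\<epsilon> T. 0 < \<epsilon> \<longrightarrow> set_integrable lborel {\<epsilon>..T} f) \<and>
     ((\<lambda>(\<epsilon>, T). LBINT t:{\<epsilon>..T}. f t) \<longlongrightarrow> L) (at_right 0 \<times>\<^sub>F at_top)"

end

theory Submission
  imports Defs
begin

text \<open>
  Everything rests on one deterministic identity, the Mellin transform of the remainder \<open>h_fun n\<close>:
  \[ \int_0^\infty \frac{h_n(t)}{t^{s+1}}\,dt = \frac{\pi}{2\,\Gamma(s+1)\cos((s-2n)\pi/2)}, \]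
  valid for \<open>2 n - 1 < s < 2 n + 1\<close> (with \<open>s > 0\<close> when \<open>n = 0\<close>). Replacing \<open>t\<close> by \<open>t * x\<close>
  multiplies the left-hand side by \<open>x powr s\<close>; putting \<open>x = X \<omega>\<close>, taking expectations and exchanging
  the two integrals gives the moment formulas. For \<open>n \<ge> 1\<close> the remainder is nonnegative on the positive
  half-line, so the exchange is Tonelli's theorem and the identity holds in \<open>[0, \<infinity>]\<close>
  (\<open>nn_integral_powr_eq_nn_integral_h_fun\<close>). If the moment of order \<open>s\<close> is finite, so are the moments
  occurring in \<open>H_fun\<close>, and \<open>H_fun M X n t\<close> is the expectation of \<open>h_fun n (t * X \<omega>)\<close>
  (\<open>integral_powr_eq_integral_H_fun\<close>). For \<open>n = 0\<close> the integrand changes sign and the exchange is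
  justified by absolute integrability (\<open>integral_powr_eq_integral_sin\<close>).

  The Mellin transform is obtained without contour integration. Writing \<open>t powr - (s + 1)\<close> as
  \<open>1 / Gamma (s + 1)\<close> times the integral of \<open>u powr s * exp (- (t * u))\<close> over \<open>u > 0\<close> reduces it to the
  Laplace transform of \<open>h_fun n\<close>. There the subtracted Taylor polynomial removes exactly the first \<open>n\<close>
  terms of the geometric series of \<open>1 / (1 + u\<^sup>2)\<close> in powers of \<open>1 / u\<^sup>2\<close>, which leaves the single
  positive function \<open>1 / (u ^ (2 * n) * (1 + u\<^sup>2))\<close> (\<open>has_bochner_integral_h_fun_exp\<close>). What remains is
  the integral of \<open>u powr a / (1 + u\<^sup>2)\<close> with \<open>a = s - 2 n\<close>, which the reflection formula for \<open>Gamma\<close>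
  evaluates (\<open>nn_integral_powr_div_one_plus_square\<close>).

  For the improper integral, Fubini's theorem on \<open>{\<epsilon>..T}\<close> turns the integral of the expectation into the
  expectation of \<open>Si (T * X \<omega>) - Si (\<epsilon> * X \<omega>)\<close>. The sine integral is bounded and continuous, tends to
  \<open>pi / 2\<close> at infinity and vanishes at \<open>0\<close>, so dominated convergence gives \<open>pi / 2\<close> for every
  distribution of a positive \<open>X\<close>.
\<close>

section \<open>Gamma integrals and the integral of a power over one plus a square\<close>

text \<open>
  The substitution \<open>w = c * u powr p\<close> in Euler's integral for \<open>Gamma z\<close>. The exponent \<open>p = 1\<close> gives the
  Laplace transform of powers; \<open>p = 2\<close> gives the Gaussian moments.
\<close>
lemma nn_integral_powr_exp_powr:
  fixes c p z :: real
  assumes "c > 0" "p > 0" "z > 0"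
  shows "(\<integral>\<^sup>+u\<in>{0<..}. ennreal (u powr (p * z - 1) * exp (- (c * u powr p))) \<partial>lborel) =
         ennreal (Gamma z / (p * c powr z))"
proof -
  define f where "f = (\<lambda>w::real. w powr (z - 1) / exp w)"
  define g where "g = (\<lambda>u::real. c * u powr p)"
  define g' where "g' = (\<lambda>u::real. c * (p * u powr (p - 1)))"
  have "((\<lambda>w. if w \<in> {0<..} then f w else 0) has_integral Gamma z) {0..}"
    by (rule has_integral_spike [of "{0}", rotated 2])
       (use Gamma_integral_real[OF \<open>z > 0\<close>] in \<open>auto simp: f_def\<close>)
  then have f_int: "(f has_integral Gamma z) {0<..}"
    by (subst (asm) has_integral_restrict) auto
  have "y \<in> g ` {0<..}" if "y > 0" for y
  proof (rule image_eqI)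
    show "y = g ((y / c) powr (1 / p))"
      using assms that by (simp add: g_def powr_powr)
    show "(y / c) powr (1 / p) \<in> {0<..}"
      using assms that by simp
  qed
  then have g_image: "g ` {0<..} = {0<..}"
    using assms by (auto simp: g_def)
  have "((\<lambda>u. \<bar>g' u\<bar> * f (g u)) absolutely_integrable_on {0<..} \<and>
          integral {0<..} (\<lambda>u. \<bar>g' u\<bar> * f (g u)) = Gamma z)
        \<longleftrightarrow> f absolutely_integrable_on (g ` {0<..}) \<and> integral (g ` {0<..}) f = Gamma z"
  proof (rule has_absolute_integral_change_of_variables_1')
    show "(g has_field_derivative g' u) (at u within {0<..})" if "u \<in> {0<..}" for u
      using that unfolding g_def g'_def
      by (auto intro!: derivative_eq_intros simp: field_simps powr_diff)
    show "inj_on g {0<..}"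
    proof (rule inj_onI)
      fix x y assume "x \<in> {0<..}" "y \<in> {0<..}" "g x = g y"
      then have "(x powr p) powr (1 / p) = (y powr p) powr (1 / p)" "0 < x" "0 < y"
        using assms by (simp_all add: g_def)
      then show "x = y"
        using assms by (simp add: powr_powr)
    qed
  qed auto
  moreover have "f absolutely_integrable_on {0<..}"
    using f_int by (intro nonnegative_absolutely_integrable_1) (auto simp: f_def has_integral_iff)
  ultimately have "((\<lambda>u. \<bar>g' u\<bar> * f (g u)) has_integral Gamma z) {0<..}"
    using f_int unfolding g_image has_integral_iff
    by (auto dest: set_lebesgue_integral_eq_integral(1))
  then have "((\<lambda>u. 1 / (p * c powr z) * (\<bar>g' u\<bar> * f (g u))) has_integral
              1 / (p * c powr z) * Gamma z) {0<..}"
    by (rule has_integral_mult_right)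
  moreover have "1 / (p * c powr z) * (\<bar>g' u\<bar> * f (g u)) = u powr (p * z - 1) * exp (- (c * u powr p))"
    if "u \<in> {0<..}" for u
  proof -
    have "u powr (p - 1) * (u powr p) powr (z - 1) = u powr (p * z - 1)"
      unfolding powr_powr powr_add[symmetric] by (simp add: algebra_simps)
    moreover have "c * c powr (z - 1) = c powr z"
      using assms by (simp add: powr_diff)
    moreover have "\<bar>g' u\<bar> * f (g u) =
      p * (c * c powr (z - 1)) * (u powr (p - 1) * (u powr p) powr (z - 1)) / exp (c * u powr p)"
      using assms that by (simp add: g'_def g_def f_def powr_mult abs_mult)
    ultimately show ?thesis
      using assms by (simp add: exp_minus field_simps)
  qed
  ultimately have "((\<lambda>u. u powr (p * z - 1) * exp (- (c * u powr p))) has_integral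
              1 / (p * c powr z) * Gamma z) {0<..}"
    by (subst has_integral_cong[symmetric]) auto
  from nn_integral_has_integral_lebesgue'[OF _ this] show ?thesis
    by simp
qed

lemma nn_integral_powr_exp:
  fixes c s :: real
  assumes "c > 0" "s > -1"
  shows "(\<integral>\<^sup>+u\<in>{0<..}. ennreal (u powr s * exp (- (c * u))) \<partial>lborel) =
         ennreal (Gamma (s + 1) / c powr (s + 1))"
proof -
  have "(\<integral>\<^sup>+u\<in>{0<..}. ennreal (u powr s * exp (- (c * u))) \<partial>lborel) =
        (\<integral>\<^sup>+u\<in>{0<..}. ennreal (u powr (1 * (s + 1) - 1) * exp (- (c * u powr 1))) \<partial>lborel)"
    by (intro nn_integral_cong) (auto split: split_indicator)
  also have "\<dots> = ennreal (Gamma (s + 1) / c powr (s + 1))"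
    using assms by (subst nn_integral_powr_exp_powr) auto
  finally show ?thesis .
qed

lemma Gamma_reflection_real:
  fixes x :: real
  shows "Gamma x * Gamma (1 - x) = pi / sin (pi * x)"
proof -
  have "complex_of_real (Gamma (1 - x)) = Gamma (1 - complex_of_real x)"
    by (simp flip: Gamma_complex_of_real)
  moreover have "sin (complex_of_real pi * complex_of_real x) = complex_of_real (sin (pi * x))"
    by (simp only: sin_of_real flip: of_real_mult)
  ultimately have "complex_of_real (Gamma x * Gamma (1 - x)) = complex_of_real (pi / sin (pi * x))"
    using Gamma_reflection_complex[of "complex_of_real x"]
    by (simp add: Gamma_complex_of_real)
  then show ?thesis
    by (simp only: of_real_eq_iff)
qed

text \<open>
  With \<open>1 / (1 + u\<^sup>2)\<close> written as the integral of \<open>exp (- ((1 + u\<^sup>2) * v))\<close> over \<open>v > 0\<close>, integrating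
  over \<open>u\<close> first produces \<open>Gamma b / 2\<close> with \<open>b = (a + 1) / 2\<close>, and then integrating over \<open>v\<close> produces
  \<open>Gamma (1 - b)\<close>. The reflection formula evaluates the product.
\<close>
lemma nn_integral_powr_div_one_plus_square:
  fixes a :: real
  assumes "-1 < a" "a < 1"
  shows "(\<integral>\<^sup>+u\<in>{0<..}. ennreal (u powr a / (1 + u\<^sup>2)) \<partial>lborel) = ennreal (pi / (2 * cos (a * pi / 2)))"
proof -
  define b where "b = (a + 1) / 2"
  have b: "0 < b" "b < 1"
    using assms by (auto simp: b_def)
  have a: "2 * b - 1 = a"
    by (simp add: b_def field_simps)
  have "(\<integral>\<^sup>+u\<in>{0<..}. ennreal (u powr a / (1 + u\<^sup>2)) \<partial>lborel) =
        (\<integral>\<^sup>+u. \<integral>\<^sup>+v. ennreal (u powr a * exp (- ((1 + u\<^sup>2) * v))) *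
            indicator {0<..} u * indicator {0<..} v \<partial>lborel \<partial>lborel)"
  proof (intro nn_integral_cong)
    fix u :: real
    have "(\<integral>\<^sup>+v. ennreal (u powr a * exp (- ((1 + u\<^sup>2) * v))) * indicator {0<..} u * indicator {0<..} v \<partial>lborel) =
        (\<integral>\<^sup>+v. (ennreal (u powr a) * indicator {0<..} u) *
                (ennreal (v powr 0 * exp (- ((1 + u\<^sup>2) * v))) * indicator {0<..} v) \<partial>lborel)"
      by (intro nn_integral_cong) (auto simp: ennreal_mult' split: split_indicator)
    also have "\<dots> = (ennreal (u powr a) * indicator {0<..} u) * ennreal (1 / (1 + u\<^sup>2))"
      using add_pos_nonneg[of 1 "u\<^sup>2"]
      by (subst nn_integral_cmult) (auto simp: nn_integral_powr_exp simp del: powr_zero_eq_one)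
    also have "\<dots> = ennreal (u powr a / (1 + u\<^sup>2)) * indicator {0<..} u"
      by (auto simp: ennreal_mult'[symmetric] split: split_indicator)
    finally show "ennreal (u powr a / (1 + u\<^sup>2)) * indicator {0<..} u =
      (\<integral>\<^sup>+v. ennreal (u powr a * exp (- ((1 + u\<^sup>2) * v))) * indicator {0<..} u * indicator {0<..} v \<partial>lborel)"
      by simp
  qed
  also have "\<dots> = (\<integral>\<^sup>+v. \<integral>\<^sup>+u. ennreal (u powr a * exp (- ((1 + u\<^sup>2) * v))) *
            indicator {0<..} u * indicator {0<..} v \<partial>lborel \<partial>lborel)"
    by (rule lborel_pair.Fubini') simp
  also have "\<dots> = (\<integral>\<^sup>+v. ennreal (Gamma b / 2) *
                (ennreal (v powr (-b) * exp (- (1 * v))) * indicator {0<..} v) \<partial>lborel)"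
  proof (intro nn_integral_cong)
    fix v :: real
    have "(\<integral>\<^sup>+u. ennreal (u powr a * exp (- ((1 + u\<^sup>2) * v))) * indicator {0<..} u * indicator {0<..} v \<partial>lborel) =
       (\<integral>\<^sup>+u. (ennreal (exp (-v)) * indicator {0<..} v) *
            (ennreal (u powr a * exp (- (v * u powr 2))) * indicator {0<..} u) \<partial>lborel)"
      by (intro nn_integral_cong)
         (auto simp: ennreal_mult'[symmetric] distrib_right exp_diff exp_minus field_simps split: split_indicator)
    also have "\<dots> = (ennreal (exp (-v)) * indicator {0<..} v) * ennreal (Gamma b / (2 * v powr b))"
    proof (cases "v > 0")
      case True
      then show ?thesis
        using b nn_integral_powr_exp_powr[of v 2 b] by (subst nn_integral_cmult) (auto simp: a)
    qed auto
    also have "\<dots> = ennreal (Gamma b / 2) * (ennreal (v powr (-b) * exp (- (1 * v))) * indicator {0<..} v)"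
    proof (cases "v > 0")
      case True
      have "ennreal (exp (-v)) * ennreal (Gamma b / (2 * v powr b)) =
            ennreal (exp (-v) * (Gamma b / (2 * v powr b)))"
        using Gamma_real_pos[OF b(1)] by (intro ennreal_mult[symmetric]) auto
      also have "exp (-v) * (Gamma b / (2 * v powr b)) = Gamma b / 2 * (v powr (-b) * exp (- (1 * v)))"
        using True by (simp add: powr_minus field_simps)
      also have "ennreal \<dots> = ennreal (Gamma b / 2) * ennreal (v powr (-b) * exp (- (1 * v)))"
        using Gamma_real_pos[OF b(1)] by (intro ennreal_mult) auto
      finally show ?thesis
        using True by simp
    qed auto
    finally show "(\<integral>\<^sup>+u. ennreal (u powr a * exp (- ((1 + u\<^sup>2) * v))) * indicator {0<..} u * indicator {0<..} v \<partial>lborel) = \<dots>" .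
  qed
  also have "\<dots> = ennreal (Gamma b / 2) * ennreal (Gamma (1 - b))"
    using b nn_integral_powr_exp[of 1 "-b"] by (subst nn_integral_cmult) auto
  also have "\<dots> = ennreal (Gamma b * Gamma (1 - b) / 2)"
    using b Gamma_real_pos[of b] Gamma_real_pos[of "1 - b"] by (simp flip: ennreal_mult'')
  also have "sin (pi * b) = cos (a * pi / 2)"
  proof -
    have "pi * b = pi / 2 + a * pi / 2"
      by (simp add: b_def field_simps)
    then show ?thesis
      by (simp only: sin_add) simp
  qed
  then have "Gamma b * Gamma (1 - b) / 2 = pi / (2 * cos (a * pi / 2))"
    by (simp add: Gamma_reflection_real)
  finally show ?thesis .
qed

lemma cos_half_pi_pos:
  fixes a :: real
  assumes "-1 < a" "a < 1"
  shows "cos (a * pi / 2) > 0"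
proof (rule cos_gt_zero_pi)
  show "- (pi / 2) < a * pi / 2" "a * pi / 2 < pi / 2"
    using mult_strict_right_mono[OF assms(1) pi_gt_zero] mult_strict_right_mono[OF assms(2) pi_gt_zero]
    by auto
qed

lemma has_bochner_integral_powr_div_one_plus_square:
  fixes a :: real
  assumes "-1 < a" "a < 1"
  shows "has_bochner_integral lborel (\<lambda>u. indicator {0<..} u * (u powr a / (1 + u\<^sup>2)))
           (pi / (2 * cos (a * pi / 2)))"
proof (rule has_bochner_integral_nn_integral)
  have "(\<integral>\<^sup>+u. ennreal (indicator {0<..} u * (u powr a / (1 + u\<^sup>2))) \<partial>lborel) =
        (\<integral>\<^sup>+u\<in>{0<..}. ennreal (u powr a / (1 + u\<^sup>2)) \<partial>lborel)"
    by (intro nn_integral_cong) (auto split: split_indicator)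
  also have "\<dots> = ennreal (pi / (2 * cos (a * pi / 2)))"
    using assms by (rule nn_integral_powr_div_one_plus_square)
  finally show "(\<integral>\<^sup>+u. ennreal (indicator {0<..} u * (u powr a / (1 + u\<^sup>2))) \<partial>lborel) =
      ennreal (pi / (2 * cos (a * pi / 2)))" .
  show "0 \<le> pi / (2 * cos (a * pi / 2))"
    using cos_half_pi_pos[OF assms] by simp
qed auto

section \<open>The remainders of the sine series\<close>

lemma h_fun_eq_sum_lessThan:
  "h_fun n t = (-1) ^ n * (sin t - (\<Sum>k<n. (-1) ^ k / fact (2 * k + 1) * t ^ (2 * k + 1)))"
  by (simp add: h_fun_def sum.atLeast1_atMost_eq)

lemma borel_measurable_h_fun [measurable]: "h_fun n \<in> borel_measurable borel"
  unfolding h_fun_def by measurable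

lemma h_fun_zero [simp]: "h_fun n 0 = 0"
  by (simp add: h_fun_eq_sum_lessThan)

text \<open>
  The companion of \<open>h_fun\<close> for the cosine series. It is the derivative of \<open>h_fun n\<close>, and its own derivative
  is \<open>h_fun (n - 1)\<close> for \<open>n > 0\<close>; this chain carries the sign of \<open>h_fun\<close> from one index to the next.
\<close>
definition cos_remainder :: "nat \<Rightarrow> real \<Rightarrow> real" where
  "cos_remainder n t = (-1) ^ n * (cos t - (\<Sum>k<n. (-1) ^ k / fact (2 * k) * t ^ (2 * k)))"

text \<open>
  Differentiation shifts the terms of an exponential series; the terms of both the sine and the cosine series
  have this shape.
\<close>
lemma has_field_derivative_power_div_fact:
  fixes c t :: real
  shows "((\<lambda>t. c / fact (Suc m) * t ^ Suc m) has_real_derivative c / fact m * t ^ m) (at t)"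
proof -
  have "((\<lambda>t. c / fact (Suc m) * t ^ Suc m) has_real_derivative
         c / fact (Suc m) * (real (Suc m) * t ^ (Suc m - Suc 0))) (at t)"
    by (intro DERIV_cmult DERIV_pow)
  also have "c / fact (Suc m) * (real (Suc m) * t ^ (Suc m - Suc 0)) = c / fact m * t ^ m"
    by (simp del: of_nat_Suc)
  finally show ?thesis .
qed

lemma has_field_derivative_h_fun: "(h_fun n has_real_derivative cos_remainder n t) (at t)"
proof -
  have "((\<lambda>t. (-1) ^ k / fact (2 * k + 1) * t ^ (2 * k + 1)) has_real_derivative
         (-1) ^ k / fact (2 * k) * t ^ (2 * k)) (at t)" for k
    using has_field_derivative_power_div_fact[of "(-1) ^ k" "2 * k" t] by simp
  then show ?thesis
    unfolding h_fun_eq_sum_lessThan[abs_def] cos_remainder_def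
    by (intro DERIV_cmult DERIV_diff DERIV_sin DERIV_sum)
qed

lemma has_field_derivative_cos_remainder:
  "(cos_remainder (Suc n) has_real_derivative h_fun n t) (at t)"
proof -
  have "((\<lambda>t. (-1) ^ Suc k / fact (2 * Suc k) * t ^ (2 * Suc k)) has_real_derivative
         - ((-1) ^ k / fact (2 * k + 1) * t ^ (2 * k + 1))) (at t)" for k
    using has_field_derivative_power_div_fact[of "(-1) ^ Suc k" "2 * k + 1" t]
    by (simp del: fact_Suc power_Suc add: power_Suc[of "-1"])
  then have "((\<lambda>t. (-1) ^ Suc n * (cos t - (1 + (\<Sum>k<n. (-1) ^ Suc k / fact (2 * Suc k) * t ^ (2 * Suc k)))))
      has_real_derivative
      (-1) ^ Suc n * (- sin t - (0 + (\<Sum>k<n. - ((-1) ^ k / fact (2 * k + 1) * t ^ (2 * k + 1)))))) (at t)"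
    by (intro DERIV_cmult DERIV_diff DERIV_cos DERIV_add DERIV_const DERIV_sum)
  also have "(\<lambda>t. (-1) ^ Suc n * (cos t - (1 + (\<Sum>k<n. (-1) ^ Suc k / fact (2 * Suc k) * t ^ (2 * Suc k))))) =
             cos_remainder (Suc n)"
    by (simp add: cos_remainder_def sum.lessThan_Suc_shift fun_eq_iff del: sum.lessThan_Suc)
  also have "(-1) ^ Suc n * (- sin t - (0 + (\<Sum>k<n. - ((-1) ^ k / fact (2 * k + 1) * t ^ (2 * k + 1))))) = h_fun n t"
    by (simp add: h_fun_eq_sum_lessThan sum_negf algebra_simps)
  finally show ?thesis .
qed

text \<open>
  The second derivative of \<open>h_fun (Suc n)\<close> is \<open>h_fun n\<close>, and both \<open>h_fun (Suc n)\<close> and its first derivative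
  vanish at \<open>0\<close>. Two monotonicity arguments therefore carry the sign from \<open>n\<close> to \<open>Suc n\<close>, starting from
  \<open>sin t \<le> t\<close>. At \<open>n = 0\<close> the function is the sine itself, which has no sign.
\<close>
lemma h_fun_nonneg:
  assumes "n \<ge> 1" "t \<ge> 0"
  shows "h_fun n t \<ge> 0"
  using assms
proof (induction n arbitrary: t rule: nat_induct_at_least)
  case base
  then show ?case
    using sin_x_le_x[of t] by (simp add: h_fun_def)
next
  case (Suc n)
  have "0 \<le> cos_remainder (Suc n) x" if "x \<ge> 0" for x
  proof -
    have "cos_remainder (Suc n) 0 \<le> cos_remainder (Suc n) x"
      using that Suc.IH has_field_derivative_cos_remainder
      by (intro DERIV_nonneg_imp_nondecreasing[where f = "cos_remainder (Suc n)"]) blast+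
    then show ?thesis
      by (simp add: cos_remainder_def sum.lessThan_Suc_shift del: sum.lessThan_Suc)
  qed
  then have "h_fun (Suc n) 0 \<le> h_fun (Suc n) t"
    using \<open>t \<ge> 0\<close> has_field_derivative_h_fun
    by (intro DERIV_nonneg_imp_nondecreasing[where f = "h_fun (Suc n)"]) blast+
  then show ?case
    by simp
qed

section \<open>Laplace transforms\<close>

lemma has_bochner_integral_powr_exp:
  fixes u s :: real
  assumes "u > 0" "s > -1"
  shows "has_bochner_integral lborel (\<lambda>t. indicator {0<..} t * (t powr s * exp (- (u * t))))
           (Gamma (s + 1) / u powr (s + 1))"
proof (rule has_bochner_integral_nn_integral)
  have "(\<integral>\<^sup>+t. ennreal (indicator {0<..} t * (t powr s * exp (- (u * t)))) \<partial>lborel) =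
        (\<integral>\<^sup>+t\<in>{0<..}. ennreal (t powr s * exp (- (u * t))) \<partial>lborel)"
    by (intro nn_integral_cong) (auto split: split_indicator)
  also have "\<dots> = ennreal (Gamma (s + 1) / u powr (s + 1))"
    using assms by (rule nn_integral_powr_exp)
  finally show "(\<integral>\<^sup>+t. ennreal (indicator {0<..} t * (t powr s * exp (- (u * t)))) \<partial>lborel) =
      ennreal (Gamma (s + 1) / u powr (s + 1))" .
qed (use assms Gamma_real_pos[of "s + 1"] in auto)

lemma has_bochner_integral_power_exp:
  fixes u :: real
  assumes "u > 0"
  shows "has_bochner_integral lborel (\<lambda>t. indicator {0<..} t * (t ^ m * exp (- (u * t)))) (fact m / u ^ (m + 1))"
proof -
  have "has_bochner_integral lborel (\<lambda>t. indicator {0<..} t * (t powr real m * exp (- (u * t))))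
          (Gamma (real m + 1) / u powr (real m + 1))"
    using assms by (intro has_bochner_integral_powr_exp) auto
  also have "(\<lambda>t. indicator {0<..} t * (t powr real m * exp (- (u * t)))) =
             (\<lambda>t. indicator {0<..} t * (t ^ m * exp (- (u * t))))"
    by (auto simp: fun_eq_iff powr_realpow split: split_indicator)
  also have "Gamma (real m + 1) / u powr (real m + 1) = fact m / u ^ (m + 1)"
    using Gamma_fact[of m, where 'a = real] powr_realpow[OF assms, of "m + 1"] by (simp add: add.commute)
  finally show ?thesis .
qed

lemma has_bochner_integral_sin_exp:
  fixes u :: real
  assumes "u > 0"
  shows "has_bochner_integral lborel (\<lambda>t. indicator {0<..} t * (sin t * exp (- (u * t)))) (1 / (1 + u\<^sup>2))"
proof -
  \<comment> \<open>\<open>F\<close> is the antiderivative found by integrating by parts twice.\<close>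
  define F where "F = (\<lambda>t. - (exp (- (u * t)) * (u * sin t + cos t)) / (1 + u\<^sup>2))"
  have nz: "1 + u\<^sup>2 \<noteq> 0"
    using zero_le_power2[of u] by linarith
  have "set_integrable lborel {0<..} (\<lambda>t. sin t * exp (- (u * t)))"
    using integrable_I0i_exp_mscale[OF assms]
  proof (rule set_integrable_bound)
    show "AE t in lborel. t \<in> {0<..} \<longrightarrow> norm (sin t * exp (- (u * t))) \<le> norm (exp (- (t * u)))"
      by (auto simp: abs_mult mult.commute[of u] mult_left_le_one_le)
  qed (auto simp: set_borel_measurable_def)
  then have int: "set_integrable lborel (einterval 0 \<infinity>) (\<lambda>t. sin t * exp (- (u * t)))"
    by (simp add: zero_ereal_def)
  have exp0: "((\<lambda>t. exp (- (u * t))) \<longlongrightarrow> 0) at_top"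
    using assms
    by (auto intro!: exp_at_bot[THEN filterlim_compose] filterlim_tendsto_pos_mult_at_top filterlim_ident
             simp: filterlim_uminus_at_bot)
  have "(LBINT t=0..\<infinity>. sin t * exp (- (u * t))) = 0 - F 0"
  proof (rule interval_integral_FTC_integrable[OF _ _ _ int])
    show "(F has_vector_derivative sin t * exp (- (u * t))) (at t)" for t
      unfolding F_def using nz
      by (auto intro!: derivative_eq_intros simp: has_real_derivative_iff_has_vector_derivative[symmetric])
         (simp_all add: field_simps power2_eq_square)
    show "isCont (\<lambda>t. sin t * exp (- (u * t))) t" for t
      by (intro continuous_intros)
    have "isCont F 0"
      unfolding F_def using nz by (intro continuous_intros) auto
    then have "(F \<longlongrightarrow> F 0) (at_right 0)"
      by (simp add: continuous_at_imp_continuous_at_within continuous_within[symmetric])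
    then show "((F \<circ> real_of_ereal) \<longlongrightarrow> F 0) (at_right 0)"
      by (simp add: zero_ereal_def ereal_tendsto_simps)
    have "(F \<longlongrightarrow> 0) at_top"
    proof (rule Lim_null_comparison)
      show "\<forall>\<^sub>F t in at_top. norm (F t) \<le> exp (- (u * t)) * (u + 1) / (1 + u\<^sup>2)"
      proof (rule always_eventually, rule allI)
        fix t
        have "\<bar>u * sin t + cos t\<bar> \<le> u + 1"
          using abs_triangle_ineq[of "u * sin t" "cos t"] abs_cos_le_one[of t]
            mult_left_mono[OF abs_sin_le_one[of t], of u] assms unfolding abs_mult by linarith
        then show "norm (F t) \<le> exp (- (u * t)) * (u + 1) / (1 + u\<^sup>2)"
          by (simp add: F_def abs_mult divide_right_mono)
      qed
      show "((\<lambda>t. exp (- (u * t)) * (u + 1) / (1 + u\<^sup>2)) \<longlongrightarrow> 0) at_top"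
        using tendsto_mult_left_zero[OF exp0, of "(u + 1) / (1 + u\<^sup>2)"] by simp
    qed
    then show "((F \<circ> real_of_ereal) \<longlongrightarrow> 0) (at_left \<infinity>)"
      by (simp add: ereal_tendsto_simps)
  qed auto
  then have "(LBINT t:{0<..}. sin t * exp (- (u * t))) = 1 / (1 + u\<^sup>2)"
    by (simp add: interval_lebesgue_integral_0_infty F_def)
  with \<open>set_integrable lborel {0<..} (\<lambda>t. sin t * exp (- (u * t)))\<close> show ?thesis
    by (simp add: has_bochner_integral_iff set_integrable_def set_lebesgue_integral_def)
qed

text \<open>
  The monomials of the Taylor polynomial transform into the terms of the geometric series
  \<open>1 / (1 + u\<^sup>2) = 1 / u\<^sup>2 - 1 / u ^ 4 + \<dots>\<close>. Removing its first \<open>n\<close> terms leaves the remainder of the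
  series, which is again a single fraction.
\<close>
lemma has_bochner_integral_h_fun_exp:
  fixes u :: real
  assumes "u > 0"
  shows "has_bochner_integral lborel (\<lambda>t. indicator {0<..} t * (h_fun n t * exp (- (u * t))))
           (1 / (u ^ (2 * n) * (1 + u\<^sup>2)))"
proof -
  have "has_bochner_integral lborel
      (\<lambda>t. (-1) ^ n * (indicator {0<..} t * (sin t * exp (- (u * t))) -
         (\<Sum>k<n. (-1) ^ k / fact (2 * k + 1) * (indicator {0<..} t * (t ^ (2 * k + 1) * exp (- (u * t)))))))
      ((-1) ^ n * (1 / (1 + u\<^sup>2) - (\<Sum>k<n. (-1) ^ k / fact (2 * k + 1) * (fact (2 * k + 1) / u ^ (2 * k + 1 + 1)))))"
    by (intro has_bochner_integral_mult_right has_bochner_integral_diff has_bochner_integral_sum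
          has_bochner_integral_sin_exp has_bochner_integral_power_exp assms)
  also have "(\<lambda>t. (-1) ^ n * (indicator {0<..} t * (sin t * exp (- (u * t))) -
         (\<Sum>k<n. (-1) ^ k / fact (2 * k + 1) * (indicator {0<..} t * (t ^ (2 * k + 1) * exp (- (u * t))))))) =
      (\<lambda>t. indicator {0<..} t * (h_fun n t * exp (- (u * t))))"
    by (auto simp: h_fun_eq_sum_lessThan fun_eq_iff left_diff_distrib right_diff_distrib
          sum_distrib_left sum_distrib_right mult_ac split: split_indicator)
  also have "(\<Sum>k<n. (-1) ^ k / fact (2 * k + 1) * (fact (2 * k + 1) / u ^ (2 * k + 1 + 1))) =
             (\<Sum>k<n. (-1) ^ k / u ^ (2 * k + 2))"
    by (intro sum.cong refl) (simp del: fact_Suc)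
  also have "(-1) ^ n * (1 / (1 + u\<^sup>2) - (\<Sum>k<n. (-1) ^ k / u ^ (2 * k + 2))) =
      1 / (u ^ (2 * n) * (1 + u\<^sup>2))"
  proof (induction n)
    case (Suc n)
    define S where "S = (\<Sum>k<n. (-1) ^ k / u ^ (2 * k + 2))"
    have "(-1) ^ Suc n * (1 / (1 + u\<^sup>2) - (\<Sum>k<Suc n. (-1) ^ k / u ^ (2 * k + 2)))
       = - ((-1) ^ n * (1 / (1 + u\<^sup>2) - S)) + ((-1) ^ n * (-1) ^ n) / u ^ (2 * n + 2)"
      by (simp add: S_def algebra_simps)
    also have "\<dots> = - (1 / (u ^ (2 * n) * (1 + u\<^sup>2))) + 1 / u ^ (2 * n + 2)"
      using Suc.IH unfolding S_def by (simp flip: power_mult_distrib)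
    also have "\<dots> = 1 / (u ^ (2 * Suc n) * (1 + u\<^sup>2))"
      using assms add_pos_pos[of 1 "u\<^sup>2"] by (simp add: divide_simps power2_eq_square)
    finally show ?case .
  qed simp
  finally show ?thesis .
qed

section \<open>Mellin transforms\<close>

text \<open>
  Tonelli's theorem, applied to \<open>h_fun n t * u powr s * exp (- (t * u))\<close>. Integration over \<open>u\<close> yields
  \<open>Gamma (s + 1)\<close> times the desired integrand; integration over \<open>t\<close> is the Laplace transform. The range
  of \<open>s\<close> is exactly \<open>-1 < s - 2 n < 1\<close>, where the resulting integral over \<open>u\<close> converges.
\<close>
lemma nn_integral_h_fun_powr:
  fixes s :: real
  assumes n: "n \<ge> 1" and s: "2 * real n - 1 < s" "s < 2 * real n + 1"
  shows "(\<integral>\<^sup>+t\<in>{0<..}. ennreal (h_fun n t / t powr (s + 1)) \<partial>lborel) =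
         ennreal (pi / (2 * Gamma (s + 1) * cos ((s - 2 * real n) * pi / 2)))"
    (is "?I = _")
proof -
  have Gamma_pos: "Gamma (s + 1) > 0"
    using n s by (intro Gamma_real_pos) auto
  have "ennreal (Gamma (s + 1)) * ?I =
        (\<integral>\<^sup>+t. ennreal (Gamma (s + 1)) * (ennreal (h_fun n t / t powr (s + 1)) * indicator {0<..} t) \<partial>lborel)"
    by (subst nn_integral_cmult) auto
  also have "\<dots> = (\<integral>\<^sup>+t. \<integral>\<^sup>+u. ennreal (h_fun n t) * ennreal (u powr s * exp (- (t * u))) *
            indicator {0<..} t * indicator {0<..} u \<partial>lborel \<partial>lborel)"
  proof (intro nn_integral_cong)
    fix t :: real
    show "ennreal (Gamma (s + 1)) * (ennreal (h_fun n t / t powr (s + 1)) * indicator {0<..} t) =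
      (\<integral>\<^sup>+u. ennreal (h_fun n t) * ennreal (u powr s * exp (- (t * u))) *
            indicator {0<..} t * indicator {0<..} u \<partial>lborel)"
    proof (cases "t > 0")
      case True
      then have h: "h_fun n t \<ge> 0"
        using n by (intro h_fun_nonneg) auto
      have "(\<integral>\<^sup>+u. ennreal (h_fun n t) * ennreal (u powr s * exp (- (t * u))) *
            indicator {0<..} t * indicator {0<..} u \<partial>lborel) =
          (\<integral>\<^sup>+u. ennreal (h_fun n t) * (ennreal (u powr s * exp (- (t * u))) * indicator {0<..} u) \<partial>lborel)"
        using True by (intro nn_integral_cong) (simp add: mult_ac)
      also have "\<dots> = ennreal (h_fun n t) * ennreal (Gamma (s + 1) / t powr (s + 1))"
        using True n s nn_integral_powr_exp[of t s] by (subst nn_integral_cmult) auto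
      also have "\<dots> = ennreal (h_fun n t * (Gamma (s + 1) / t powr (s + 1)))"
        using h Gamma_pos by (intro ennreal_mult[symmetric]) auto
      also have "\<dots> = ennreal (Gamma (s + 1) * (h_fun n t / t powr (s + 1)))"
        by (simp add: mult_ac)
      also have "\<dots> = ennreal (Gamma (s + 1)) * ennreal (h_fun n t / t powr (s + 1))"
        using h Gamma_pos by (intro ennreal_mult) auto
      finally show ?thesis
        using True by simp
    qed auto
  qed
  also have "\<dots> = (\<integral>\<^sup>+u. \<integral>\<^sup>+t. ennreal (h_fun n t) * ennreal (u powr s * exp (- (t * u))) *
            indicator {0<..} t * indicator {0<..} u \<partial>lborel \<partial>lborel)"
    by (rule lborel_pair.Fubini') simp
  also have "\<dots> = (\<integral>\<^sup>+u\<in>{0<..}. ennreal (u powr (s - 2 * real n) / (1 + u\<^sup>2)) \<partial>lborel)"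
  proof (intro nn_integral_cong)
    fix u :: real
    show "(\<integral>\<^sup>+t. ennreal (h_fun n t) * ennreal (u powr s * exp (- (t * u))) *
            indicator {0<..} t * indicator {0<..} u \<partial>lborel) =
          ennreal (u powr (s - 2 * real n) / (1 + u\<^sup>2)) * indicator {0<..} u"
    proof (cases "u > 0")
      case True
      have "(\<integral>\<^sup>+t. ennreal (h_fun n t) * ennreal (u powr s * exp (- (t * u))) *
            indicator {0<..} t * indicator {0<..} u \<partial>lborel) =
          (\<integral>\<^sup>+t. ennreal (u powr s * (indicator {0<..} t * (h_fun n t * exp (- (u * t))))) \<partial>lborel)"
        using True n h_fun_nonneg[of n]
        by (intro nn_integral_cong) (auto simp: mult_ac ennreal_mult'[symmetric] split: split_indicator)
      also have "\<dots> = ennreal (u powr s * (1 / (u ^ (2 * n) * (1 + u\<^sup>2))))"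
        using has_bochner_integral_mult_right[OF has_bochner_integral_h_fun_exp[OF True, of n], of "u powr s"]
          n h_fun_nonneg[of n]
        by (subst nn_integral_eq_integral) (auto simp: has_bochner_integral_iff split: split_indicator)
      also have "u powr s * (1 / (u ^ (2 * n) * (1 + u\<^sup>2))) = u powr (s - 2 * real n) / (1 + u\<^sup>2)"
        using True powr_realpow[OF True, of "2 * n"] by (simp add: powr_diff)
      finally show ?thesis
        using True by simp
    qed auto
  qed
  also have "\<dots> = ennreal (pi / (2 * cos ((s - 2 * real n) * pi / 2)))"
    using s by (intro nn_integral_powr_div_one_plus_square) auto
  finally have "ennreal (Gamma (s + 1)) * ?I = ennreal (pi / (2 * cos ((s - 2 * real n) * pi / 2)))" .
  then have "ennreal (1 / Gamma (s + 1)) * (ennreal (Gamma (s + 1)) * ?I) =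
      ennreal (1 / Gamma (s + 1)) * ennreal (pi / (2 * cos ((s - 2 * real n) * pi / 2)))"
    by simp
  also have "ennreal (1 / Gamma (s + 1)) * (ennreal (Gamma (s + 1)) * ?I) = ?I"
    using Gamma_pos by (simp add: mult.assoc[symmetric] flip: ennreal_mult')
  also have "ennreal (1 / Gamma (s + 1)) * ennreal (pi / (2 * cos ((s - 2 * real n) * pi / 2))) =
      ennreal (1 / Gamma (s + 1) * (pi / (2 * cos ((s - 2 * real n) * pi / 2))))"
    using Gamma_pos by (intro ennreal_mult'[symmetric]) auto
  finally show ?thesis
    by (simp add: mult_ac)
qed

text \<open>
  The integrand is dominated by integrands already evaluated. For \<open>t > 0\<close>, \<open>\<bar>sin t\<bar> \<le> min t 1 \<le> 2 * (t + t\<^sup>2) / (1 + t\<^sup>2)\<close>,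
  and dividing the bound by \<open>t powr (s + 1)\<close> leaves \<open>t powr a / (1 + t\<^sup>2)\<close> for \<open>a = - s\<close>, which controls the
  behaviour at \<open>0\<close>, and for \<open>a = 1 - s\<close>, which controls the behaviour at infinity.
\<close>
lemma integrable_sin_powr:
  fixes s :: real
  assumes s: "0 < s" "s < 1"
  shows "integrable lborel (\<lambda>t. indicator {0<..} t * (sin t / t powr (s + 1)))"
proof (rule Bochner_Integration.integrable_bound)
  show "integrable lborel (\<lambda>t. 2 * (indicator {0<..} t * (t powr (-s) / (1 + t\<^sup>2)) +
      indicator {0<..} t * (t powr (1 - s) / (1 + t\<^sup>2))))"
    using has_bochner_integral_powr_div_one_plus_square[of "-s"]
      has_bochner_integral_powr_div_one_plus_square[of "1 - s"] s
    by (intro integrable_mult_right Bochner_Integration.integrable_add) (auto simp: has_bochner_integral_iff)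
  show "AE t in lborel. norm (indicator {0<..} t * (sin t / t powr (s + 1))) \<le>
      norm (2 * (indicator {0<..} t * (t powr (-s) / (1 + t\<^sup>2)) +
      indicator {0<..} t * (t powr (1 - s) / (1 + t\<^sup>2))))"
  proof (rule AE_I2)
    fix t :: real
    show "norm (indicator {0<..} t * (sin t / t powr (s + 1))) \<le>
      norm (2 * (indicator {0<..} t * (t powr (-s) / (1 + t\<^sup>2)) +
      indicator {0<..} t * (t powr (1 - s) / (1 + t\<^sup>2))))"
    proof (cases "t > 0")
      case True
      have pos: "1 + t\<^sup>2 > 0"
        by (simp add: add_pos_nonneg)
      have "\<bar>sin t\<bar> * (1 + t\<^sup>2) \<le> 2 * (t + t\<^sup>2)"
      proof (cases "t \<le> 1")
        case True
        with \<open>t > 0\<close> have "\<bar>sin t\<bar> * (1 + t\<^sup>2) \<le> t * 2"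
          using abs_sin_x_le_abs_x[of t] by (intro mult_mono) (auto simp: power_le_one)
        then show ?thesis
          by (simp add: add_increasing2)
      next
        case False
        then have "1 \<le> t\<^sup>2"
          by simp
        then have "1 * (1 + t\<^sup>2) \<le> 2 * (t + t\<^sup>2)"
          using \<open>t > 0\<close> by simp
        moreover have "\<bar>sin t\<bar> * (1 + t\<^sup>2) \<le> 1 * (1 + t\<^sup>2)"
          by (intro mult_right_mono) auto
        ultimately show ?thesis
          by (rule order_trans[rotated])
      qed
      then have "\<bar>sin t\<bar> \<le> 2 * (t + t\<^sup>2) / (1 + t\<^sup>2)"
        using pos by (simp add: field_simps)
      then have "\<bar>sin t\<bar> / t powr (s + 1) \<le> 2 * (t + t\<^sup>2) / (1 + t\<^sup>2) / t powr (s + 1)"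
        by (intro divide_right_mono) auto
      also have "t powr (s + 1) = t * t powr s"
        using True by (simp add: powr_add)
      also have "2 * (t + t\<^sup>2) / (1 + t\<^sup>2) / (t * t powr s) = 2 * (t powr (-s) / (1 + t\<^sup>2) + t powr (1 - s) / (1 + t\<^sup>2))"
      proof -
        have "2 * (t + t\<^sup>2) / d / (t * p) = 2 * (1 / p / d + t / p / d)" if "d > 0" "p > 0" for d p :: real
          using that True by (simp add: field_simps power2_eq_square)
        from this[OF pos, of "t powr s"] True show ?thesis
          by (simp add: powr_minus_divide powr_diff)
      qed
      finally show ?thesis
        using True by (simp add: powr_add mult.commute)
    qed auto
  qed
qed auto

text \<open>
  The same exchange of integrals for \<open>n = 0\<close>. Since the sine changes sign, absolute integrability on the
  product is established first; the integral of the absolute value over \<open>u\<close> leads back to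
  \<open>integrable_sin_powr\<close>.
\<close>
lemma has_bochner_integral_sin_powr:
  fixes s :: real
  assumes s: "0 < s" "s < 1"
  shows "has_bochner_integral lborel (\<lambda>t. indicator {0<..} t * (sin t / t powr (s + 1)))
           (pi / (2 * Gamma (s + 1) * cos (s * pi / 2)))"
proof -
  let ?f = "\<lambda>t u. (indicator {0<..} t * sin t) * (indicator {0<..} u * (u powr s * exp (- (t * u))))"
  have Gamma_pos: "Gamma (s + 1) > 0"
    using s by (intro Gamma_real_pos) auto
  have inner_u: "has_bochner_integral lborel (?f t)
      (Gamma (s + 1) * (indicator {0<..} t * (sin t / t powr (s + 1))))" for t
  proof (cases "t > 0")
    case True
    then show ?thesis
      using has_bochner_integral_mult_right[OF has_bochner_integral_powr_exp[of t s], of "indicator {0<..} t * sin t"] s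
      by (simp add: mult_ac)
  qed auto
  have inner_t: "has_bochner_integral lborel (\<lambda>t. ?f t u) (indicator {0<..} u * (u powr s / (1 + u\<^sup>2)))" for u
  proof (cases "u > 0")
    case True
    then show ?thesis
      using has_bochner_integral_mult_right[OF has_bochner_integral_sin_exp[of u], of "u powr s"]
      by (simp add: mult_ac)
  qed auto
  have norm_f: "norm (?f t u) = \<bar>indicator {0<..} t * sin t\<bar> * (indicator {0<..} u * (u powr s * exp (- (t * u))))" for t u
    by (simp add: abs_mult)
  have "(\<integral>u. norm (?f t u) \<partial>lborel) = norm (Gamma (s + 1) * (indicator {0<..} t * (sin t / t powr (s + 1))))" for t
  proof (cases "t > 0")
    case True
    then show ?thesis
      using has_bochner_integral_powr_exp[of t s] s Gamma_pos unfolding norm_f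
      by (simp add: has_bochner_integral_iff abs_mult)
  qed auto
  moreover have "integrable lborel (\<lambda>t. norm (Gamma (s + 1) * (indicator {0<..} t * (sin t / t powr (s + 1)))))"
    by (intro integrable_norm integrable_mult_right integrable_sin_powr s)
  ultimately have int: "integrable (lborel \<Otimes>\<^sub>M lborel) (case_prod ?f)"
    using inner_u by (intro lborel_pair.Fubini_integrable)
      (auto simp: has_bochner_integral_iff simp del: real_norm_def mult_eq_0_iff)
  have "(\<integral>t. Gamma (s + 1) * (indicator {0<..} t * (sin t / t powr (s + 1))) \<partial>lborel) =
        (\<integral>t. \<integral>u. ?f t u \<partial>lborel \<partial>lborel)"
    using inner_u by (simp add: has_bochner_integral_iff)
  also have "\<dots> = (\<integral>u. \<integral>t. ?f t u \<partial>lborel \<partial>lborel)"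
    by (rule lborel_pair.Fubini_integral[OF int, symmetric])
  also have "\<dots> = (\<integral>u. indicator {0<..} u * (u powr s / (1 + u\<^sup>2)) \<partial>lborel)"
    using inner_t by (simp add: has_bochner_integral_iff)
  also have "\<dots> = pi / (2 * cos (s * pi / 2))"
    using has_bochner_integral_powr_div_one_plus_square[of s] s by (simp add: has_bochner_integral_iff)
  finally have "Gamma (s + 1) * (\<integral>t. indicator {0<..} t * (sin t / t powr (s + 1)) \<partial>lborel) =
      pi / (2 * cos (s * pi / 2))"
    by (simp only: integral_mult_right_zero)
  then have "(\<integral>t. indicator {0<..} t * (sin t / t powr (s + 1)) \<partial>lborel) = pi / (2 * cos (s * pi / 2)) / Gamma (s + 1)"
    using Gamma_pos by (subst nonzero_eq_divide_eq) (simp_all only: mult.commute less_imp_neq[symmetric] not_False_eq_True)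
  with integrable_sin_powr[OF s] show ?thesis
    by (simp add: has_bochner_integral_iff mult_ac)
qed

section \<open>Scaling\<close>

text \<open>
  The measure \<open>dt / t\<close> on the positive half-line is invariant under scaling, so only the factor
  \<open>t powr - s\<close> feels the substitution. This is how the power of \<open>X\<close> appears in the moment formulas.
\<close>
lemma nn_integral_scale_div_powr:
  fixes f :: "real \<Rightarrow> real" and s x :: real
  assumes [measurable]: "f \<in> borel_measurable borel" and x: "x > 0"
  shows "(\<integral>\<^sup>+t\<in>{0<..}. ennreal (f (t * x) / t powr (s + 1)) \<partial>lborel) =
         ennreal (x powr s) * (\<integral>\<^sup>+t\<in>{0<..}. ennreal (f t / t powr (s + 1)) \<partial>lborel)"
proof -
  have "(\<integral>\<^sup>+t\<in>{0<..}. ennreal (f t / t powr (s + 1)) \<partial>lborel) =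
      ennreal x * (\<integral>\<^sup>+t. ennreal (f (x * t) / (x * t) powr (s + 1)) * indicator {0<..} (x * t) \<partial>lborel)"
    using x by (subst nn_integral_real_affine[where c = x and t = 0]) auto
  then have "ennreal (x powr s) * (\<integral>\<^sup>+t\<in>{0<..}. ennreal (f t / t powr (s + 1)) \<partial>lborel) =
      ennreal (x powr s) * ennreal x *
        (\<integral>\<^sup>+t. ennreal (f (x * t) / (x * t) powr (s + 1)) * indicator {0<..} (x * t) \<partial>lborel)"
    by (simp add: mult_ac)
  also have "ennreal (x powr s) * ennreal x = ennreal (x powr (s + 1))"
    using x by (simp add: powr_add flip: ennreal_mult)
  also have "ennreal (x powr (s + 1)) *
        (\<integral>\<^sup>+t. ennreal (f (x * t) / (x * t) powr (s + 1)) * indicator {0<..} (x * t) \<partial>lborel) =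
      (\<integral>\<^sup>+t. ennreal (x powr (s + 1)) * (ennreal (f (x * t) / (x * t) powr (s + 1)) * indicator {0<..} (x * t)) \<partial>lborel)"
    by (rule nn_integral_cmult[symmetric]) simp
  also have "\<dots> = (\<integral>\<^sup>+t\<in>{0<..}. ennreal (f (t * x) / t powr (s + 1)) \<partial>lborel)"
  proof (intro nn_integral_cong)
    fix t :: real
    show "ennreal (x powr (s + 1)) * (ennreal (f (x * t) / (x * t) powr (s + 1)) * indicator {0<..} (x * t)) =
          ennreal (f (t * x) / t powr (s + 1)) * indicator {0<..} t"
    proof (cases "t > 0")
      case True
      have "ennreal (x powr (s + 1)) * ennreal (f (x * t) / (x * t) powr (s + 1)) =
            ennreal (x powr (s + 1) * (f (x * t) / (x * t) powr (s + 1)))"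
        by (intro ennreal_mult'[symmetric]) auto
      also have "x powr (s + 1) * (f (x * t) / (x * t) powr (s + 1)) = f (t * x) / t powr (s + 1)"
        using True x by (simp add: powr_mult mult.commute)
      finally show ?thesis
        using True x by simp
    next
      case False
      then show ?thesis
        using x by (simp add: zero_less_mult_iff)
    qed
  qed
  finally show ?thesis ..
qed

lemma has_bochner_integral_scale_div_powr:
  fixes f :: "real \<Rightarrow> real" and s x :: real
  assumes "has_bochner_integral lborel (\<lambda>t. indicator {0<..} t * (f t / t powr (s + 1))) I" and x: "x > 0"
  shows "has_bochner_integral lborel (\<lambda>t. indicator {0<..} t * (f (t * x) / t powr (s + 1))) (x powr s * I)"
proof -
  have "has_bochner_integral lborel (\<lambda>t. indicator {0<..} (x * t) * (f (x * t) / (x * t) powr (s + 1))) (I / x)"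
    using lborel_has_bochner_integral_real_affine_iff[of x "\<lambda>t. indicator {0<..} t * (f t / t powr (s + 1))" I 0] assms
    by (simp add: divide_inverse mult.commute)
  then have "has_bochner_integral lborel
      (\<lambda>t. x powr (s + 1) * (indicator {0<..} (x * t) * (f (x * t) / (x * t) powr (s + 1))))
      (x powr (s + 1) * (I / x))"
    by (rule has_bochner_integral_mult_right)
  also have "(\<lambda>t. x powr (s + 1) * (indicator {0<..} (x * t) * (f (x * t) / (x * t) powr (s + 1)))) =
      (\<lambda>t. indicator {0<..} t * (f (t * x) / t powr (s + 1)))"
    using x by (auto simp: fun_eq_iff powr_mult mult.commute zero_less_mult_iff split: split_indicator)
  also have "x powr (s + 1) * (I / x) = x powr s * I"
    using x by (simp add: powr_add)
  finally show ?thesis .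
qed

section \<open>Moments as integrals over the positive half-line\<close>

context prob_space
begin

text \<open>
  After Tonelli's theorem, the inner integral over \<open>t\<close> is the Mellin transform of \<open>h_fun n\<close> scaled by
  \<open>X \<omega>\<close>, that is \<open>X \<omega> powr s / c\<close> where \<open>c\<close> is the constant of the formula.
\<close>
lemma nn_integral_powr_eq_nn_integral_h_fun:
  fixes X :: "'a \<Rightarrow> real" and s :: real
  assumes [measurable]: "X \<in> borel_measurable M" and X: "AE \<omega> in M. X \<omega> \<ge> 0"
    and n: "n \<ge> 1" and s: "2 * real n - 1 < s" "s < 2 * real n + 1"
  shows "(\<integral>\<^sup>+\<omega>. ennreal (X \<omega> powr s) \<partial>M) =
       ennreal (2 / pi * Gamma (s + 1) * cos ((s - 2 * real n) * pi / 2)) *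
         (\<integral>\<^sup>+t\<in>{0<..}. ((\<integral>\<^sup>+\<omega>. ennreal (h_fun n (t * X \<omega>)) \<partial>M) / ennreal (t powr (s + 1))) \<partial>lborel)"
proof -
  interpret lborel_M: pair_sigma_finite lborel M ..
  define c where "c = 2 / pi * Gamma (s + 1) * cos ((s - 2 * real n) * pi / 2)"
  have Gamma_pos: "Gamma (s + 1) > 0"
    using n s by (intro Gamma_real_pos) auto
  have cos_pos: "cos ((s - 2 * real n) * pi / 2) > 0"
    using s by (intro cos_half_pi_pos) auto
  have c: "c > 0"
    using Gamma_pos cos_pos by (simp add: c_def)
  have "pi / (2 * Gamma (s + 1) * cos ((s - 2 * real n) * pi / 2)) = 1 / c"
    by (simp add: c_def)
  then have mellin: "(\<integral>\<^sup>+t\<in>{0<..}. ennreal (h_fun n t / t powr (s + 1)) \<partial>lborel) = ennreal (1 / c)"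
    using nn_integral_h_fun_powr[OF n s] by simp
  have "(\<integral>\<^sup>+t\<in>{0<..}. ((\<integral>\<^sup>+\<omega>. ennreal (h_fun n (t * X \<omega>)) \<partial>M) / ennreal (t powr (s + 1))) \<partial>lborel) =
        (\<integral>\<^sup>+t. \<integral>\<^sup>+\<omega>. ennreal (h_fun n (t * X \<omega>) / t powr (s + 1)) * indicator {0<..} t \<partial>M \<partial>lborel)"
  proof (intro nn_integral_cong)
    fix t :: real
    show "(\<integral>\<^sup>+\<omega>. ennreal (h_fun n (t * X \<omega>)) \<partial>M) / ennreal (t powr (s + 1)) * indicator {0<..} t =
          (\<integral>\<^sup>+\<omega>. ennreal (h_fun n (t * X \<omega>) / t powr (s + 1)) * indicator {0<..} t \<partial>M)"
    proof (cases "t > 0")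
      case True
      have "(\<integral>\<^sup>+\<omega>. ennreal (h_fun n (t * X \<omega>)) \<partial>M) / ennreal (t powr (s + 1)) =
            (\<integral>\<^sup>+\<omega>. ennreal (h_fun n (t * X \<omega>)) / ennreal (t powr (s + 1)) \<partial>M)"
        by (rule nn_integral_divide[symmetric]) simp
      also have "\<dots> = (\<integral>\<^sup>+\<omega>. ennreal (h_fun n (t * X \<omega>) / t powr (s + 1)) \<partial>M)"
        using X by (intro nn_integral_cong_AE, eventually_elim)
          (use True n in \<open>auto intro!: divide_ennreal h_fun_nonneg\<close>)
      finally show ?thesis
        using True by simp
    qed auto
  qed
  also have "\<dots> = (\<integral>\<^sup>+\<omega>. \<integral>\<^sup>+t. ennreal (h_fun n (t * X \<omega>) / t powr (s + 1)) * indicator {0<..} t \<partial>lborel \<partial>M)"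
    by (rule lborel_M.Fubini'[symmetric]) simp
  also have "\<dots> = (\<integral>\<^sup>+\<omega>. ennreal (X \<omega> powr s) * ennreal (1 / c) \<partial>M)"
    using X
  proof (intro nn_integral_cong_AE, eventually_elim)
    case (elim \<omega>)
    show ?case
    \<comment> \<open>Scaling by \<open>X \<omega>\<close> needs \<open>X \<omega> \<noteq> 0\<close>; at zero both sides vanish, since \<open>0 powr s = 0\<close>.\<close>
    proof (cases "X \<omega> = 0")
      case False
      with elim show ?thesis
        using nn_integral_scale_div_powr[of "h_fun n" "X \<omega>" s] by (simp add: mellin)
    qed auto
  qed
  also have "\<dots> = (\<integral>\<^sup>+\<omega>. ennreal (X \<omega> powr s) \<partial>M) * ennreal (1 / c)"
    by (rule nn_integral_multc) simp
  finally have "ennreal c * (\<integral>\<^sup>+t\<in>{0<..}. ((\<integral>\<^sup>+\<omega>. ennreal (h_fun n (t * X \<omega>)) \<partial>M) / ennreal (t powr (s + 1))) \<partial>lborel) =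
      (ennreal c * ennreal (1 / c)) * (\<integral>\<^sup>+\<omega>. ennreal (X \<omega> powr s) \<partial>M)"
    by (simp add: mult_ac)
  also have "ennreal c * ennreal (1 / c) = 1"
    using c by (simp flip: ennreal_mult)
  finally show ?thesis
    by (simp add: c_def)
qed

lemma Im_char_distr:
  assumes [measurable]: "X \<in> borel_measurable M"
  shows "Im (char (distr M borel X) t) = (\<integral>\<omega>. sin (t * X \<omega>) \<partial>M)"
proof -
  have int: "integrable M (\<lambda>\<omega>. iexp (t * X \<omega>))"
    by (rule integrable_const_bound[where B = 1]) auto
  have "char (distr M borel X) t = (\<integral>\<omega>. iexp (t * X \<omega>) \<partial>M)"
    unfolding char_def by (subst integral_distr) auto
  then show ?thesis
    using integral_Im[OF int] by (simp add: Im_exp)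
qed

text \<open>
  For \<open>x \<ge> 0\<close> and \<open>m \<le> s\<close> the bound \<open>x ^ m \<le> 1 + x powr s\<close> holds because one of the summands dominates on each side of \<open>1\<close>.
\<close>
lemma integrable_power_of_integrable_powr:
  fixes X :: "'a \<Rightarrow> real" and s :: real
  assumes [measurable]: "X \<in> borel_measurable M" and X: "AE \<omega> in M. X \<omega> \<ge> 0"
    and int: "integrable M (\<lambda>\<omega>. X \<omega> powr s)" and m: "real m \<le> s"
  shows "integrable M (\<lambda>\<omega>. X \<omega> ^ m)"
proof (rule Bochner_Integration.integrable_bound)
  show "integrable M (\<lambda>\<omega>. 1 + X \<omega> powr s)"
    using int by auto
  show "AE \<omega> in M. norm (X \<omega> ^ m) \<le> norm (1 + X \<omega> powr s)"
    using X
  proof eventually_elim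
    case (elim \<omega>)
    show ?case
    proof (cases "X \<omega> \<le> 1")
      case True
      then have "X \<omega> ^ m \<le> 1"
        using elim by (intro power_le_one)
      also have "1 \<le> 1 + X \<omega> powr s"
        by simp
      finally show ?thesis
        using elim by simp
    next
      case False
      then have "X \<omega> ^ m = X \<omega> powr real m"
        by (simp add: powr_realpow)
      also have "\<dots> \<le> X \<omega> powr s"
        using False m by (intro powr_mono) auto
      finally show ?thesis
        using elim by simp
    qed
  qed
qed auto

text \<open>
  Linearity of the expectation. Finiteness of the odd moments is what makes the Bochner integrals in
  \<open>H_fun\<close> the true moments; otherwise they default to \<open>0\<close>.
\<close>
lemma H_fun_eq_expectation_h_fun:
  fixes X :: "'a \<Rightarrow> real"
  assumes [measurable]: "X \<in> borel_measurable M"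
    and int: "\<And>k. 1 \<le> k \<Longrightarrow> k \<le> n \<Longrightarrow> integrable M (\<lambda>\<omega>. X \<omega> ^ (2 * k - 1))"
  shows "has_bochner_integral M (\<lambda>\<omega>. h_fun n (t * X \<omega>)) (H_fun M X n t)"
proof -
  have sin: "has_bochner_integral M (\<lambda>\<omega>. sin (t * X \<omega>)) (Im (char (distr M borel X) t))"
    unfolding Im_char_distr[OF assms(1)]
    by (rule has_bochner_integral_integrable) (auto intro!: integrable_const_bound[where B = 1])
  have "has_bochner_integral M (\<lambda>\<omega>. (-1) ^ n * (sin (t * X \<omega>) -
         (\<Sum>k=1..n. ((-1) ^ (k + 1) / fact (2 * k - 1)) * t ^ (2 * k - 1) * X \<omega> ^ (2 * k - 1))))
      ((-1) ^ n * (Im (char (distr M borel X) t) -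
         (\<Sum>k=1..n. ((-1) ^ (k + 1) / fact (2 * k - 1)) * t ^ (2 * k - 1) * (\<integral>\<omega>. X \<omega> ^ (2 * k - 1) \<partial>M))))"
    using int by (intro has_bochner_integral_mult_right has_bochner_integral_diff has_bochner_integral_sum
        sin has_bochner_integral_integrable) auto
  also have "(\<lambda>\<omega>. (-1) ^ n * (sin (t * X \<omega>) -
         (\<Sum>k=1..n. ((-1) ^ (k + 1) / fact (2 * k - 1)) * t ^ (2 * k - 1) * X \<omega> ^ (2 * k - 1)))) =
      (\<lambda>\<omega>. h_fun n (t * X \<omega>))"
    by (simp add: h_fun_def power_mult_distrib mult.assoc)
  also have "(-1) ^ n * (Im (char (distr M borel X) t) -
         (\<Sum>k=1..n. ((-1) ^ (k + 1) / fact (2 * k - 1)) * t ^ (2 * k - 1) * (\<integral>\<omega>. X \<omega> ^ (2 * k - 1) \<partial>M))) =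
      H_fun M X n t"
    using Im_char_distr[OF assms(1), of t] by (simp add: H_fun_def mult_ac)
  finally show ?thesis .
qed

text \<open>
  A finite moment of order \<open>s\<close> makes both sides of the identity in \<open>[0, \<infinity>]\<close> finite, and the inner
  integral is then \<open>H_fun M X n t\<close>. As this is nonnegative for \<open>t > 0\<close>, finiteness of its integral is
  integrability.
\<close>
lemma integral_powr_eq_integral_H_fun:
  fixes X :: "'a \<Rightarrow> real" and s :: real
  assumes [measurable]: "X \<in> borel_measurable M" and X: "AE \<omega> in M. X \<omega> \<ge> 0"
    and n: "n \<ge> 1" and s: "2 * real n - 1 < s" "s < 2 * real n + 1"
    and int: "integrable M (\<lambda>\<omega>. X \<omega> powr s)"
  shows "set_integrable lborel {0<..} (\<lambda>t. H_fun M X n t / t powr (s + 1))"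
    and "(\<integral>\<omega>. X \<omega> powr s \<partial>M) = 2 / pi * Gamma (s + 1) * cos ((s - 2 * real n) * pi / 2) *
         (LBINT t:{0<..}. H_fun M X n t / t powr (s + 1))"
proof -
  define c where "c = 2 / pi * Gamma (s + 1) * cos ((s - 2 * real n) * pi / 2)"
  define g where "g = (\<lambda>t. indicator {0<..} t * (H_fun M X n t / t powr (s + 1)))"
  define m where "m = (\<integral>\<omega>. X \<omega> powr s \<partial>M)"
  have "Gamma (s + 1) > 0"
    using n s by (intro Gamma_real_pos) auto
  moreover have "cos ((s - 2 * real n) * pi / 2) > 0"
    using s by (intro cos_half_pi_pos) auto
  ultimately have c: "c > 0"
    by (simp add: c_def)
  have H: "has_bochner_integral M (\<lambda>\<omega>. h_fun n (t * X \<omega>)) (H_fun M X n t)" for t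
  proof (rule H_fun_eq_expectation_h_fun)
    fix k assume k: "1 \<le> k" "k \<le> n"
    then have "real (2 * k - 1) \<le> s"
      using s by simp
    then show "integrable M (\<lambda>\<omega>. X \<omega> ^ (2 * k - 1))"
      using integrable_power_of_integrable_powr[OF assms(1) X int] by blast
  qed simp
  have H_eq: "H_fun M X n = (\<lambda>t. \<integral>\<omega>. h_fun n (t * X \<omega>) \<partial>M)"
    using H by (simp add: has_bochner_integral_iff)
  have [measurable]: "H_fun M X n \<in> borel_measurable borel"
    unfolding H_eq by measurable
  have h_nonneg: "AE \<omega> in M. 0 \<le> h_fun n (t * X \<omega>)" if "t > 0" for t
    using X by eventually_elim (use that n in \<open>auto intro!: h_fun_nonneg\<close>)
  have g_nonneg: "g t \<ge> 0" for t
    using h_nonneg[of t] by (auto simp: g_def H_eq intro!: integral_nonneg_AE divide_nonneg_nonneg split: split_indicator)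
  have "(\<integral>\<^sup>+t. ennreal (g t) \<partial>lborel) =
        (\<integral>\<^sup>+t\<in>{0<..}. ((\<integral>\<^sup>+\<omega>. ennreal (h_fun n (t * X \<omega>)) \<partial>M) / ennreal (t powr (s + 1))) \<partial>lborel)"
  proof (intro nn_integral_cong)
    fix t :: real
    show "ennreal (g t) = (\<integral>\<^sup>+\<omega>. ennreal (h_fun n (t * X \<omega>)) \<partial>M) / ennreal (t powr (s + 1)) * indicator {0<..} t"
    proof (cases "t > 0")
      case True
      have "(\<integral>\<^sup>+\<omega>. ennreal (h_fun n (t * X \<omega>)) \<partial>M) = ennreal (H_fun M X n t)"
        using H[of t] h_nonneg[OF True] by (subst nn_integral_eq_integral) (auto simp: has_bochner_integral_iff)
      moreover have "H_fun M X n t \<ge> 0"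
        using h_nonneg[OF True] by (auto simp: H_eq intro!: integral_nonneg_AE)
      ultimately show ?thesis
        using True by (simp add: g_def divide_ennreal)
    qed (auto simp: g_def)
  qed
  then have "ennreal c * (\<integral>\<^sup>+t. ennreal (g t) \<partial>lborel) = (\<integral>\<^sup>+\<omega>. ennreal (X \<omega> powr s) \<partial>M)"
    using nn_integral_powr_eq_nn_integral_h_fun[OF assms(1) X n s] by (simp add: c_def)
  also have "\<dots> = ennreal m"
    unfolding m_def using int by (intro nn_integral_eq_integral) auto
  finally have "ennreal (1 / c) * (ennreal c * (\<integral>\<^sup>+t. ennreal (g t) \<partial>lborel)) = ennreal (1 / c) * ennreal m"
    by simp
  also have "ennreal (1 / c) * (ennreal c * (\<integral>\<^sup>+t. ennreal (g t) \<partial>lborel)) = (\<integral>\<^sup>+t. ennreal (g t) \<partial>lborel)"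
    using c by (simp add: mult.assoc[symmetric] flip: ennreal_mult)
  also have "ennreal (1 / c) * ennreal m = ennreal (m / c)"
    using c by (simp flip: ennreal_mult')
  finally have g: "has_bochner_integral lborel g (m / c)"
    using g_nonneg c by (intro has_bochner_integral_nn_integral) (auto simp: g_def m_def)
  then show "set_integrable lborel {0<..} (\<lambda>t. H_fun M X n t / t powr (s + 1))"
    by (simp add: set_integrable_def g_def has_bochner_integral_iff)
  have "(LBINT t:{0<..}. H_fun M X n t / t powr (s + 1)) = m / c"
    using g by (simp add: set_lebesgue_integral_def g_def has_bochner_integral_iff)
  then show "(\<integral>\<omega>. X \<omega> powr s \<partial>M) = 2 / pi * Gamma (s + 1) * cos ((s - 2 * real n) * pi / 2) *
         (LBINT t:{0<..}. H_fun M X n t / t powr (s + 1))"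
    using c unfolding c_def[symmetric] m_def[symmetric] by simp
qed

text \<open>
  Fubini's theorem needs an absolutely integrable function on the product. By scaling, the integral of
  \<open>\<bar>sin (t * X \<omega>)\<bar> / t powr (s + 1)\<close> over \<open>t\<close> is a constant multiple of \<open>X \<omega> powr s\<close>, so finiteness of the
  moment is exactly what is required.
\<close>
lemma integral_powr_eq_integral_sin:
  fixes X :: "'a \<Rightarrow> real" and s :: real
  assumes [measurable]: "X \<in> borel_measurable M" and X: "AE \<omega> in M. X \<omega> \<ge> 0"
    and s: "0 < s" "s < 1"
    and int: "integrable M (\<lambda>\<omega>. X \<omega> powr s)"
  shows "set_integrable lborel {0<..} (\<lambda>t. (\<integral>\<omega>. sin (t * X \<omega>) \<partial>M) / t powr (s + 1))"
    and "(\<integral>\<omega>. X \<omega> powr s \<partial>M) = 2 / pi * Gamma (s + 1) * cos (s * pi / 2) *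
         (LBINT t:{0<..}. (\<integral>\<omega>. sin (t * X \<omega>) \<partial>M) / t powr (s + 1))"
proof -
  interpret M_lborel: pair_sigma_finite M lborel ..
  let ?f = "\<lambda>\<omega> t. indicator {0<..} t * (sin (t * X \<omega>) / t powr (s + 1))"
  define c where "c = 2 / pi * Gamma (s + 1) * cos (s * pi / 2)"
  define K where "K = (\<integral>t. indicator {0<..} t * (\<bar>sin t\<bar> / t powr (s + 1)) \<partial>lborel)"
  have Gamma_pos: "Gamma (s + 1) > 0"
    using s by (intro Gamma_real_pos) auto
  have cos_pos: "cos (s * pi / 2) > 0"
    using s by (intro cos_half_pi_pos) auto
  have c: "c > 0"
    using Gamma_pos cos_pos by (simp add: c_def)
  have "pi / (2 * Gamma (s + 1) * cos (s * pi / 2)) = 1 / c"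
    by (simp add: c_def)
  then have sin_int: "has_bochner_integral lborel (\<lambda>t. indicator {0<..} t * (sin t / t powr (s + 1))) (1 / c)"
    using has_bochner_integral_sin_powr[OF s] by simp
  have abs_sin_int: "has_bochner_integral lborel (\<lambda>t. indicator {0<..} t * (\<bar>sin t\<bar> / t powr (s + 1))) K"
    using integrable_norm[OF integrable_sin_powr[OF s]] unfolding K_def
    by (intro has_bochner_integral_integrable) (simp add: abs_mult)
  have inner: "has_bochner_integral lborel (?f \<omega>) (X \<omega> powr s * (1 / c))"
    and inner_abs: "has_bochner_integral lborel (\<lambda>t. norm (?f \<omega> t)) (X \<omega> powr s * K)" if "X \<omega> \<ge> 0" for \<omega>
  proof -
    have "has_bochner_integral lborel (?f \<omega>) (X \<omega> powr s * (1 / c)) \<and>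
        has_bochner_integral lborel (\<lambda>t. indicator {0<..} t * (\<bar>sin (t * X \<omega>)\<bar> / t powr (s + 1))) (X \<omega> powr s * K)"
    \<comment> \<open>Scaling by \<open>X \<omega>\<close> needs \<open>X \<omega> \<noteq> 0\<close>; at zero both sides vanish, since \<open>0 powr s = 0\<close>.\<close>
    proof (cases "X \<omega> = 0")
      case False
      with that show ?thesis
        by (intro conjI has_bochner_integral_scale_div_powr[of sin] has_bochner_integral_scale_div_powr[of "\<lambda>t. \<bar>sin t\<bar>"] sin_int abs_sin_int) auto
    qed (auto simp: has_bochner_integral_zero)
    then show "has_bochner_integral lborel (?f \<omega>) (X \<omega> powr s * (1 / c))"
      "has_bochner_integral lborel (\<lambda>t. norm (?f \<omega> t)) (X \<omega> powr s * K)"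
      by (auto simp: abs_mult)
  qed
  have prod_int: "integrable (M \<Otimes>\<^sub>M lborel) (case_prod ?f)"
  proof (rule M_lborel.Fubini_integrable)
    have "integrable M (\<lambda>\<omega>. X \<omega> powr s * K)"
      using int by simp
    moreover have "AE \<omega> in M. X \<omega> powr s * K = (\<integral>t. norm (?f \<omega> t) \<partial>lborel)"
      using X by eventually_elim (use inner_abs in \<open>auto simp: has_bochner_integral_iff\<close>)
    ultimately show "integrable M (\<lambda>\<omega>. \<integral>t. norm (case (\<omega>, t) of (\<omega>, t) \<Rightarrow> ?f \<omega> t) \<partial>lborel)"
      by (subst integrable_cong_AE[symmetric, where f = "\<lambda>\<omega>. X \<omega> powr s * K"]) auto
    show "AE \<omega> in M. integrable lborel (\<lambda>t. case (\<omega>, t) of (\<omega>, t) \<Rightarrow> ?f \<omega> t)"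
      using X by eventually_elim (use inner in \<open>auto simp: has_bochner_integral_iff\<close>)
  qed simp
  have f_eq: "(\<integral>\<omega>. ?f \<omega> t \<partial>M) = indicator {0<..} t * ((\<integral>\<omega>. sin (t * X \<omega>) \<partial>M) / t powr (s + 1))" for t
    by (simp only: integral_mult_right_zero integral_divide_zero)
  show "set_integrable lborel {0<..} (\<lambda>t. (\<integral>\<omega>. sin (t * X \<omega>) \<partial>M) / t powr (s + 1))"
    using M_lborel.integrable_snd[OF prod_int] unfolding f_eq set_integrable_def by simp
  have "(LBINT t:{0<..}. (\<integral>\<omega>. sin (t * X \<omega>) \<partial>M) / t powr (s + 1)) = (\<integral>t. \<integral>\<omega>. ?f \<omega> t \<partial>M \<partial>lborel)"
    unfolding f_eq set_lebesgue_integral_def by simp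
  also have "\<dots> = (\<integral>\<omega>. \<integral>t. ?f \<omega> t \<partial>lborel \<partial>M)"
    by (rule M_lborel.Fubini_integral[OF prod_int])
  also have "\<dots> = (\<integral>\<omega>. X \<omega> powr s * (1 / c) \<partial>M)"
    using X
  proof (intro integral_cong_AE, goal_cases)
    case 3
    then show ?case
      by eventually_elim (use inner in \<open>auto simp: has_bochner_integral_iff\<close>)
  qed measurable
  also have "\<dots> = (\<integral>\<omega>. X \<omega> powr s \<partial>M) / c"
    by simp
  finally show "(\<integral>\<omega>. X \<omega> powr s \<partial>M) = 2 / pi * Gamma (s + 1) * cos (s * pi / 2) *
         (LBINT t:{0<..}. (\<integral>\<omega>. sin (t * X \<omega>) \<partial>M) / t powr (s + 1))"
    using c unfolding c_def[symmetric] by simp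
qed

end

section \<open>The improper integral of the expected sine\<close>

lemma interval_lborel_integral_sin_div:
  fixes x \<epsilon> T :: real
  assumes "x > 0" "0 < \<epsilon>" "\<epsilon> \<le> T"
  shows "(LBINT t:{\<epsilon>..T}. sin (t * x) / t) = Si (T * x) - Si (\<epsilon> * x)"
proof -
  have "(LBINT t=0..\<epsilon>. sin (t * x) / t) + (LBINT t=\<epsilon>..T. sin (t * x) / t) = (LBINT t=0..T. sin (t * x) / t)"
    using assms integrable_sinc'[of T x] by (intro interval_integral_sum) (simp add: zero_ereal_def)
  then show ?thesis
    using assms by (simp add: LBINT_I0c_sin_scale_divide interval_integral_Icc)
qed

context prob_space
begin

text \<open>
  On an interval away from \<open>0\<close> the integrand is at most \<open>1 / \<epsilon>\<close> in absolute value, so Fubini's theorem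
  applies. Where \<open>X \<omega> > 0\<close>, the inner integral is a difference of two values of \<open>Si\<close>.
\<close>
lemma set_lborel_integral_expectation_sin_div:
  fixes X :: "'a \<Rightarrow> real" and \<epsilon> T :: real
  assumes [measurable]: "X \<in> borel_measurable M" and X: "AE \<omega> in M. X \<omega> > 0" and \<epsilon>: "0 < \<epsilon>"
  shows "set_integrable lborel {\<epsilon>..T} (\<lambda>t. (\<integral>\<omega>. sin (t * X \<omega>) \<partial>M) / t)"
    and "\<epsilon> \<le> T \<Longrightarrow> (LBINT t:{\<epsilon>..T}. (\<integral>\<omega>. sin (t * X \<omega>) \<partial>M) / t) =
           (\<integral>\<omega>. Si (T * X \<omega>) \<partial>M) - (\<integral>\<omega>. Si (\<epsilon> * X \<omega>) \<partial>M)"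
proof -
  interpret M_lborel: pair_sigma_finite M lborel ..
  let ?f = "\<lambda>\<omega> t. indicator {\<epsilon>..T} t * (sin (t * X \<omega>) / t)"
  have dominant: "integrable lborel (\<lambda>t. indicator {\<epsilon>..T} t * (1 / \<epsilon>))"
    by (intro integrable_mult_left integrable_real_indicator) (auto simp: emeasure_lborel_Icc_eq)
  have bound: "norm (?f \<omega> t) \<le> norm (indicator {\<epsilon>..T} t * (1 / \<epsilon>))" for \<omega> t
    using \<epsilon> by (auto intro!: frac_le split: split_indicator)
  have inner: "integrable lborel (?f \<omega>)" for \<omega>
    by (rule Bochner_Integration.integrable_bound[where f = "\<lambda>t. indicator {\<epsilon>..T} t * (1 / \<epsilon>)"])
       (use bound dominant in auto)
  have prod_int: "integrable (M \<Otimes>\<^sub>M lborel) (case_prod ?f)"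
  proof (rule M_lborel.Fubini_integrable)
    show "integrable M (\<lambda>\<omega>. \<integral>t. norm (case (\<omega>, t) of (\<omega>, t) \<Rightarrow> ?f \<omega> t) \<partial>lborel)"
    proof (rule integrable_const_bound)
      show "AE \<omega> in M. norm (\<integral>t. norm (case (\<omega>, t) of (\<omega>, t) \<Rightarrow> ?f \<omega> t) \<partial>lborel) \<le>
          (\<integral>t. norm (indicator {\<epsilon>..T} t * (1 / \<epsilon>)) \<partial>lborel)"
      proof (rule AE_I2)
        fix \<omega>
        have "(\<integral>t. norm (?f \<omega> t) \<partial>lborel) \<le> (\<integral>t. norm (indicator {\<epsilon>..T} t * (1 / \<epsilon>)) \<partial>lborel)"
          by (intro integral_mono integrable_norm bound inner dominant)
        then show "norm (\<integral>t. norm (case (\<omega>, t) of (\<omega>, t) \<Rightarrow> ?f \<omega> t) \<partial>lborel) \<le>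
          (\<integral>t. norm (indicator {\<epsilon>..T} t * (1 / \<epsilon>)) \<partial>lborel)"
          by simp
      qed
    qed simp
    show "AE \<omega> in M. integrable lborel (\<lambda>t. case (\<omega>, t) of (\<omega>, t) \<Rightarrow> ?f \<omega> t)"
      using inner by simp
  qed simp
  have f_eq: "(\<integral>\<omega>. ?f \<omega> t \<partial>M) = indicator {\<epsilon>..T} t * ((\<integral>\<omega>. sin (t * X \<omega>) \<partial>M) / t)" for t
    by (simp only: integral_mult_right_zero integral_divide_zero)
  show "set_integrable lborel {\<epsilon>..T} (\<lambda>t. (\<integral>\<omega>. sin (t * X \<omega>) \<partial>M) / t)"
    using M_lborel.integrable_snd[OF prod_int] unfolding f_eq set_integrable_def by simp
  assume "\<epsilon> \<le> T"
  obtain B where B: "\<And>t. \<bar>Si t\<bar> \<le> B"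
    using bounded_Si by blast
  have Si_int: "integrable M (\<lambda>\<omega>. Si (c * X \<omega>))" for c
    by (rule integrable_const_bound[where B = B]) (use B in auto)
  have "(LBINT t:{\<epsilon>..T}. (\<integral>\<omega>. sin (t * X \<omega>) \<partial>M) / t) = (\<integral>t. \<integral>\<omega>. ?f \<omega> t \<partial>M \<partial>lborel)"
    unfolding f_eq set_lebesgue_integral_def by simp
  also have "\<dots> = (\<integral>\<omega>. \<integral>t. ?f \<omega> t \<partial>lborel \<partial>M)"
    by (rule M_lborel.Fubini_integral[OF prod_int])
  also have "\<dots> = (\<integral>\<omega>. Si (T * X \<omega>) - Si (\<epsilon> * X \<omega>) \<partial>M)"
    using X
  proof (intro integral_cong_AE, goal_cases)
    case 3
    then show ?case
      by eventually_elim
        (use interval_lborel_integral_sin_div \<epsilon> \<open>\<epsilon> \<le> T\<close> in \<open>auto simp: set_lebesgue_integral_def\<close>)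
  qed measurable
  also have "\<dots> = (\<integral>\<omega>. Si (T * X \<omega>) \<partial>M) - (\<integral>\<omega>. Si (\<epsilon> * X \<omega>) \<partial>M)"
    by (intro Bochner_Integration.integral_diff Si_int)
  finally show "(LBINT t:{\<epsilon>..T}. (\<integral>\<omega>. sin (t * X \<omega>) \<partial>M) / t) =
           (\<integral>\<omega>. Si (T * X \<omega>) \<partial>M) - (\<integral>\<omega>. Si (\<epsilon> * X \<omega>) \<partial>M)" .
qed

text \<open>
  Both limits follow from dominated convergence with a bound of \<open>Si\<close> as the dominating constant; the
  second uses \<open>\<epsilon> = inverse T\<close> so that both are limits at infinity.
\<close>
lemma expectation_Si_limits:
  fixes X :: "'a \<Rightarrow> real"
  assumes [measurable]: "X \<in> borel_measurable M" and X: "AE \<omega> in M. X \<omega> > 0"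
  shows "((\<lambda>T. \<integral>\<omega>. Si (T * X \<omega>) \<partial>M) \<longlongrightarrow> pi / 2) at_top"
    and "((\<lambda>\<epsilon>. \<integral>\<omega>. Si (\<epsilon> * X \<omega>) \<partial>M) \<longlongrightarrow> 0) (at_right 0)"
proof -
  obtain B where B: "\<And>t. \<bar>Si t\<bar> \<le> B"
    using bounded_Si by blast
  have "((\<lambda>T. \<integral>\<omega>. Si (T * X \<omega>) \<partial>M) \<longlongrightarrow> (\<integral>\<omega>. pi / 2 \<partial>M)) at_top"
  proof (rule integral_dominated_convergence_at_top[where w = "\<lambda>_. B"])
    show "AE \<omega> in M. ((\<lambda>T. Si (T * X \<omega>)) \<longlongrightarrow> pi / 2) at_top"
      using X
    proof eventually_elim
      case (elim \<omega>)
      then have "LIM T at_top. T * X \<omega> :> at_top"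
        by (intro filterlim_at_top_mult_tendsto_pos[OF tendsto_const] filterlim_ident) auto
      then show ?case
        by (rule filterlim_compose[OF Si_at_top])
    qed
  qed (use B in auto)
  then show "((\<lambda>T. \<integral>\<omega>. Si (T * X \<omega>) \<partial>M) \<longlongrightarrow> pi / 2) at_top"
    by (simp add: prob_space)
  have "((\<lambda>T. \<integral>\<omega>. Si (inverse T * X \<omega>) \<partial>M) \<longlongrightarrow> (\<integral>\<omega>. 0 \<partial>M)) at_top"
  proof (rule integral_dominated_convergence_at_top[where w = "\<lambda>_. B"])
    show "AE \<omega> in M. ((\<lambda>T. Si (inverse T * X \<omega>)) \<longlongrightarrow> 0) at_top"
    proof (rule AE_I2)
      fix \<omega>
      have "((\<lambda>T. inverse T * X \<omega>) \<longlongrightarrow> 0) at_top"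
        using tendsto_mult_left_zero[OF tendsto_inverse_0_at_top[OF filterlim_ident], of "X \<omega>"] .
      then have "((\<lambda>T. Si (inverse T * X \<omega>)) \<longlongrightarrow> Si 0) at_top"
        by (rule isCont_tendsto_compose[OF isCont_Si])
      then show "((\<lambda>T. Si (inverse T * X \<omega>)) \<longlongrightarrow> 0) at_top"
        by (simp add: Si_def zero_ereal_def)
    qed
  qed (use B in auto)
  then show "((\<lambda>\<epsilon>. \<integral>\<omega>. Si (\<epsilon> * X \<omega>) \<partial>M) \<longlongrightarrow> 0) (at_right 0)"
    by (simp add: filterlim_at_right_to_top)
qed

text \<open>
  The integral over \<open>{\<epsilon>..T}\<close> splits into a function of \<open>T\<close> minus a function of \<open>\<epsilon>\<close>, so the joint limit
  reduces to two separate ones.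
\<close>
lemma has_improper_integral_expectation_sin_div:
  fixes X :: "'a \<Rightarrow> real"
  assumes [measurable]: "X \<in> borel_measurable M" and X: "AE \<omega> in M. X \<omega> > 0"
  shows "has_improper_integral_0_inf (\<lambda>t. (\<integral>\<omega>. sin (t * X \<omega>) \<partial>M) / t) (pi / 2)"
  unfolding has_improper_integral_0_inf_def
proof (intro conjI allI impI)
  show "set_integrable lborel {\<epsilon>..T} (\<lambda>t. (\<integral>\<omega>. sin (t * X \<omega>) \<partial>M) / t)" if "0 < \<epsilon>" for \<epsilon> T
    using that assms by (intro set_lborel_integral_expectation_sin_div)
  have "((\<lambda>p. (\<integral>\<omega>. Si (snd p * X \<omega>) \<partial>M) - (\<integral>\<omega>. Si (fst p * X \<omega>) \<partial>M)) \<longlongrightarrow> pi / 2 - 0)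
      (at_right 0 \<times>\<^sub>F at_top)"
    by (intro tendsto_diff filterlim_compose[OF expectation_Si_limits(1)[OF assms] filterlim_snd]
        filterlim_compose[OF expectation_Si_limits(2)[OF assms] filterlim_fst])
  moreover have "\<forall>\<^sub>F p in at_right 0 \<times>\<^sub>F at_top.
      (\<integral>\<omega>. Si (snd p * X \<omega>) \<partial>M) - (\<integral>\<omega>. Si (fst p * X \<omega>) \<partial>M) =
      (case p of (\<epsilon>, T) \<Rightarrow> LBINT t:{\<epsilon>..T}. (\<integral>\<omega>. sin (t * X \<omega>) \<partial>M) / t)"
  proof -
    \<comment> \<open>Separating \<open>\<epsilon>\<close> and \<open>T\<close> by \<open>1\<close> ensures \<open>\<epsilon> \<le> T\<close>; otherwise \<open>{\<epsilon>..T}\<close> is empty.\<close>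
    have "\<forall>\<^sub>F \<epsilon> in at_right (0 :: real). 0 < \<epsilon> \<and> \<epsilon> < 1"
      by (simp add: eventually_at_right_field) (meson zero_less_one)
    moreover have "\<forall>\<^sub>F T in at_top. (1 :: real) \<le> T"
      by (rule eventually_ge_at_top)
    ultimately have "\<forall>\<^sub>F p in at_right (0 :: real) \<times>\<^sub>F at_top. (0 < fst p \<and> fst p < 1) \<and> (1 :: real) \<le> snd p"
      by (rule eventually_prodI)
    then show ?thesis
    proof eventually_elim
      case (elim p)
      then show ?case
        using set_lborel_integral_expectation_sin_div(2)[OF assms, of "fst p" "snd p"]
        by (simp add: case_prod_beta)
    qed
  qed
  ultimately show "((\<lambda>(\<epsilon>, T). LBINT t:{\<epsilon>..T}. (\<integral>\<omega>. sin (t * X \<omega>) \<partial>M) / t) \<longlongrightarrow> pi / 2)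
      (at_right 0 \<times>\<^sub>F at_top)"
    by (simp add: tendsto_cong)
qed

end

section \<open>The moment formulas\<close>

theorem theorem2:
  fixes M :: "'a measure" and X :: "'a \<Rightarrow> real"
  assumes "prob_space M"
    and "X \<in> borel_measurable M"
    and "AE \<omega> in M. X \<omega> \<ge> 0"
  shows
   "(\<forall>(n::nat) (s::real). n \<ge> 1 \<and> s \<in> {2 * real n - 1<..<2 * real n + 1} \<longrightarrow>
       (\<integral>\<^sup>+\<omega>. ennreal (X \<omega> powr s) \<partial>M) =
       ennreal (2 / pi * Gamma (s + 1) * cos ((s - 2 * real n) * pi / 2)) *
         (\<integral>\<^sup>+t\<in>{0<..}. ((\<integral>\<^sup>+\<omega>. ennreal (h_fun n (t * X \<omega>)) \<partial>M) / ennreal (t powr (s + 1))) \<partial>lborel)) \<and>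
    (\<forall>(n::nat) (s::real). n \<ge> 1 \<and> s \<in> {2 * real n - 1<..<2 * real n + 1} \<and>
         integrable M (\<lambda>\<omega>. X \<omega> powr s) \<longrightarrow>
       set_integrable lborel {0<..} (\<lambda>t. H_fun M X n t / t powr (s + 1)) \<and>
       (LINT \<omega>|M. X \<omega> powr s) =
       2 / pi * Gamma (s + 1) * cos ((s - 2 * real n) * pi / 2) *
         (LBINT t:{0<..}. H_fun M X n t / t powr (s + 1))) \<and>
    (\<forall>s::real. s \<in> {0<..<1} \<and> integrable M (\<lambda>\<omega>. X \<omega> powr s) \<longrightarrow>
       set_integrable lborel {0<..} (\<lambda>t. (LINT \<omega>|M. sin (t * X \<omega>)) / t powr (s + 1)) \<and>
       set_integrable lborel {0<..} (\<lambda>t. H_fun M X 0 t / t powr (s + 1)) \<and>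
       (LINT \<omega>|M. X \<omega> powr s) =
       2 / pi * Gamma (s + 1) * cos (s * pi / 2) *
         (LBINT t:{0<..}. (LINT \<omega>|M. sin (t * X \<omega>)) / t powr (s + 1)) \<and>
       (LINT \<omega>|M. X \<omega> powr s) =
       2 / pi * Gamma (s + 1) * cos (s * pi / 2) *
         (LBINT t:{0<..}. H_fun M X 0 t / t powr (s + 1))) \<and>
    ((AE \<omega> in M. X \<omega> > 0) \<longrightarrow>
       has_improper_integral_0_inf (\<lambda>t. (LINT \<omega>|M. sin (t * X \<omega>)) / t) (pi / 2) \<and>
       has_improper_integral_0_inf (\<lambda>t. Im (char (distr M borel X) t) / t) (pi / 2))"
proof -
  interpret prob_space M
    by fact
  have H_0: "H_fun M X 0 = (\<lambda>t. \<integral>\<omega>. sin (t * X \<omega>) \<partial>M)"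
    by (simp add: H_fun_def fun_eq_iff)
  show ?thesis
    unfolding H_0 Im_char_distr[OF assms(2)]
    using nn_integral_powr_eq_nn_integral_h_fun[OF assms(2,3)]
      integral_powr_eq_integral_H_fun[OF assms(2,3)]
      integral_powr_eq_integral_sin[OF assms(2,3)]
      has_improper_integral_expectation_sin_div[OF assms(2)]
    by (intro conjI allI impI) (simp_all only: greaterThanLessThan_iff)
qed

end
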